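(* Let $m,n\in\mathbb{N}$ (positive integers) and $0<p,q\le\infty$. Let $B_{p,q}^{m,n}(\mathbb{R})=\{x\in\mathbb{R}^{n\times m}:\|x\|_{p,q}\le 1\}$ be the unit ball of the mixed sequence space $\ell_q^n(\ell_p^m(\mathbb{R}))$. Then $$\operatorname{vol}(B_{p,q}^{m,n}(\mathbb{R}))=2^{mn}\,\frac{\Gamma\left(\frac1p+1\right)^{mn}}{\Gamma\left(\frac{nm}{q}+1\right)}\cdot\frac{\Gamma\left(\frac mq+1\right)^n}{\Gamma\left(\frac mp+1\right)^n}.$$
   Context: For $x=(x_{j,k})_{1\le j\le n,\,1\le k\le m}\in\mathbb{R}^{n\times m}$ and $0<p,q<\infty$, $$\|x\|_{p,q}=\Biggl(\sum_{j=1}^n\Bigl(\sum_{k=1}^m |x_{j,k}|^p\Bigr)^{q/p}\Biggr)^{1/q},$$ with the usual modifications if $p$ or $q$ is infinite: if $p=\infty$ the inner expression $\bigl(\sum_{k}|x_{j,k}|^p\bigr)^{1/p}$ is replaced by $\max_{1\le k\le m}|x_{j,k}|$, and if $q=\infty$ the outer $\ell_q$-sum over $j$ is replaced by $\max_{1\le j\le n}$. The volume $\operatorname{vol}$ is Lebesgue measure on $\mathbb{R}^{n\times m}\cong\mathbb{R}^{nm}$. $\Gamma$ is the gamma function. Convention: $1/\infty=0$ (so $m/p=0$ if $p=\infty$, and $m/q=nm/q=0$ if $q=\infty$). *)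

theory Defs
  imports "HOL-Analysis.Analysis"
begin

text \<open>
  Exponents are extended reals, used only in the range from \<open>0\<close> (excluded) to \<open>\<infinity>\<close> (included).
\<close>

definition lp_norm :: "ereal \<Rightarrow> real ^ 'k \<Rightarrow> real" where
  "lp_norm p v =
     (if p = \<infinity> then Max (range (\<lambda>k. \<bar>v $ k\<bar>))
      else (\<Sum>k\<in>UNIV. \<bar>v $ k\<bar> powr real_of_ereal p) powr (1 / real_of_ereal p))"

text \<open>
  An \<open>n \<times> m\<close> matrix is an element of \<^typ>\<open>real ^ 'm ^ 'n\<close>, the inner exponent \<open>p\<close> belonging to
  the rows \<open>x $ j\<close>. Row norms are non-negative, so the outer absolute value is immaterial.
\<close>

definition mixed_norm :: "ereal \<Rightarrow> ereal \<Rightarrow> real ^ 'm ^ 'n \<Rightarrow> real" where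
  "mixed_norm p q x = lp_norm q (\<chi> j. lp_norm p (x $ j))"

lemma mixed_norm_finite_exponents:
  fixes x :: "real ^ 'm ^ 'n" and p q :: real
  shows "mixed_norm (ereal p) (ereal q) x =
    (\<Sum>j\<in>UNIV. (\<Sum>k\<in>UNIV. \<bar>x $ j $ k\<bar> powr p) powr (q / p)) powr (1 / q)"
  by (simp add: mixed_norm_def lp_norm_def powr_powr)

definition mixed_ball :: "ereal \<Rightarrow> ereal \<Rightarrow> (real ^ 'm ^ 'n) set" where
  "mixed_ball p q = {x. mixed_norm p q x \<le> 1}"

end

theory Submission
  imports Defs
begin

text \<open>
  If \<open>N\<close> is positively homogeneous on a \<open>d\<close>-dimensional space, then \<open>{N \<le> t}\<close> has volume
  \<open>V t\<^sup>d\<close> with \<open>V = vol {N \<le> 1}\<close>; integrating \<open>exp (- s)\<close> over the set \<open>{(x, s). N x powr q \<le> s}\<close>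
  in both orders gives \<open>\<integral> exp (- N x powr q) = V \<Gamma>(d / q + 1)\<close>. If \<open>F\<close> is the
  \<open>\<ell>\<^sub>q\<close>-combination of \<open>n\<close> copies of \<open>N\<close>, then \<open>exp (- F powr q)\<close> is a product of \<open>n\<close> copies of
  \<open>exp (- N powr q)\<close>, whence \<open>vol {F \<le> 1} \<Gamma>(n d / q + 1) = (V \<Gamma>(d / q + 1))\<^sup>n\<close>. For \<open>q = \<infinity>\<close> the
  unit ball itself is a product. The theorem follows by applying this step twice, first to the
  absolute value on the line and then to the rows.
\<close>

section \<open>Sublevel volumes and exponential integrals of homogeneous functions\<close>

definition pos_homogeneous :: "('a::euclidean_space \<Rightarrow> real) \<Rightarrow> bool" where
  "pos_homogeneous N \<longleftrightarrow> N \<in> borel_measurable borel \<and> (\<forall>x. 0 \<le> N x) \<and>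
     (\<forall>c x. 0 < c \<longrightarrow> N (c *\<^sub>R x) = c * N x)"

lemma pos_homogeneousD:
  assumes "pos_homogeneous N"
  shows "N \<in> borel_measurable borel" "0 \<le> N x" "0 < c \<Longrightarrow> N (c *\<^sub>R x) = c * N x"
  using assms by (auto simp: pos_homogeneous_def)

text \<open>Dilation by \<open>c\<close> carries the unit sublevel set onto the one at level
  \<open>c\<close>, with Jacobian \<open>c ^ DIM('a)\<close>. Both volumes may be infinite.\<close>

lemma emeasure_pos_homogeneous_le:
  fixes N :: "'a::euclidean_space \<Rightarrow> real"
  assumes N: "pos_homogeneous N" and c: "0 < c"
  shows "emeasure lborel {x. N x \<le> c} = ennreal (c ^ DIM('a)) * emeasure lborel {x. N x \<le> 1}"
proof -
  note [measurable] = pos_homogeneousD(1)[OF N]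
  have "emeasure lborel {x. N x \<le> c} =
      emeasure (density (distr lborel borel (\<lambda>x. 0 + c *\<^sub>R x)) (\<lambda>_. \<bar>c\<bar> ^ DIM('a))) {x. N x \<le> c}"
    using c by (subst lborel_affine[of c "0::'a"]) auto
  also have "\<dots> = ennreal (c ^ DIM('a)) * emeasure lborel {x. N (c *\<^sub>R x) \<le> c}"
    using c by (subst emeasure_density_const)
      (auto simp: emeasure_distr vimage_def ennreal_power[symmetric])
  also have "{x. N (c *\<^sub>R x) \<le> c} = {x. N x \<le> 1}"
    using c by (simp add: pos_homogeneousD(3)[OF N])
  finally show ?thesis .
qed

lemma nn_integral_exp_minus_atLeast:
  "(\<integral>\<^sup>+s. ennreal (exp (- s)) * indicator {a..} s \<partial>lborel) = ennreal (exp (- a))"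
proof -
  have "(\<integral>\<^sup>+s. ennreal (exp (- s)) * indicator {a..} s \<partial>lborel) = ennreal (0 - (- exp (- a)))"
  proof (rule nn_integral_FTC_atLeast)
    show "((\<lambda>s::real. - exp (- s)) \<longlongrightarrow> 0) at_top"
      using tendsto_minus[OF filterlim_compose[OF exp_at_bot filterlim_uminus_at_bot_at_top]]
      by simp
  qed (auto intro!: derivative_eq_intros)
  then show ?thesis by simp
qed

lemma nn_integral_exp_pos_homogeneous:
  fixes N :: "'a::euclidean_space \<Rightarrow> real"
  assumes N: "pos_homogeneous N" and q: "0 < q"
  shows "(\<integral>\<^sup>+x. ennreal (exp (- (N x powr q))) \<partial>lborel) =
    emeasure lborel {x. N x \<le> 1} * ennreal (Gamma (real DIM('a) / q + 1))"
proof -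
  note [measurable] = pos_homogeneousD(1)[OF N]
  let ?V = "emeasure lborel {x. N x \<le> 1}"
  have level: "N x powr q \<le> s \<longleftrightarrow> N x \<le> s powr (1 / q)" if "0 < s" for x s
    using that q pos_homogeneousD(2)[OF N, of x]
      powr_le_cancel_iff[of q "N x" "s powr (1 / q)"]
      powr_mono2[of q "N x" "s powr (1 / q)"] powr_mono2[of "1 / q" "N x powr q" s]
    by (auto simp: powr_powr)
  have "(\<integral>\<^sup>+x. ennreal (exp (- (N x powr q))) \<partial>lborel) =
      (\<integral>\<^sup>+x. \<integral>\<^sup>+s. ennreal (exp (- s)) * indicator {N x powr q..} s \<partial>lborel \<partial>lborel)"
    by (simp add: nn_integral_exp_minus_atLeast)
  also have "\<dots> = (\<integral>\<^sup>+x. \<integral>\<^sup>+s. (if N x powr q \<le> s then ennreal (exp (- s)) else 0) \<partial>lborel \<partial>lborel)"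
    by (intro nn_integral_cong) (auto simp: indicator_def)
  also have "\<dots> = (\<integral>\<^sup>+s. \<integral>\<^sup>+x. (if N x powr q \<le> s then ennreal (exp (- s)) else 0) \<partial>lborel \<partial>lborel)"
    by (rule lborel_pair.Fubini') measurable
  also have "\<dots> = (\<integral>\<^sup>+s. ?V * ennreal (indicator {0..} s * s powr (real DIM('a) / q + 1 - 1) / exp s) \<partial>lborel)"
  proof (rule nn_integral_cong_AE)
    \<comment> \<open>At \<open>s = 0\<close> the two sides can differ: the left one is the volume
      of the zero set of \<open>N\<close>, the right one vanishes since
      \<open>0 powr _ = 0\<close>.\<close>
    have "AE s::real in lborel. s \<noteq> 0"
      by (rule AE_lborel_singleton)
    then show "AE s in lborel. (\<integral>\<^sup>+x. (if N x powr q \<le> s then ennreal (exp (- s)) else 0) \<partial>lborel) =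
      ?V * ennreal (indicator {0..} s * s powr (real DIM('a) / q + 1 - 1) / exp s)"
    proof eventually_elim
      case (elim s)
      show ?case
      proof (cases "0 < s")
        case True
        have "(\<integral>\<^sup>+x. (if N x powr q \<le> s then ennreal (exp (- s)) else 0) \<partial>lborel) =
            (\<integral>\<^sup>+x. ennreal (exp (- s)) * indicator {x. N x \<le> s powr (1 / q)} x \<partial>lborel)"
          by (intro nn_integral_cong) (auto simp: level[OF True] indicator_def)
        also have "\<dots> = ennreal (exp (- s)) * emeasure lborel {x. N x \<le> s powr (1 / q)}"
          by (rule nn_integral_cmult_indicator) measurable
        also have "\<dots> = ennreal (exp (- s)) * (ennreal ((s powr (1 / q)) ^ DIM('a)) * ?V)"
          using True by (subst emeasure_pos_homogeneous_le[OF N]) auto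
        also have "(s powr (1 / q)) ^ DIM('a) = s powr (real DIM('a) / q)"
          using True by (simp add: powr_realpow[symmetric] powr_powr)
        finally show ?thesis
          using True by (simp add: exp_minus divide_inverse ennreal_mult mult_ac)
      next
        case False
        with elim have s: "s < 0" by simp
        then have "\<not> N x powr q \<le> s" for x
          using powr_ge_zero[of "N x" q] by linarith
        with s show ?thesis by (simp add: indicator_def)
      qed
    qed
  qed
  \<comment> \<open>Euler's integral for Gamma at \<open>DIM('a) / q + 1\<close>; the exponent was
    left as \<open>+ 1 - 1\<close> to match its integrand.\<close>
  also have "\<dots> = ?V * ennreal (Gamma (real DIM('a) / q + 1))"
    using q by (subst nn_integral_cmult) (auto simp: Gamma_conv_nn_integral_real add_pos_nonneg)
  finally show ?thesis .
qed

section \<open>Lebesgue measure on vectors as a product measure\<close>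

lemma borel_measurable_vec_nth [measurable]:
  "(\<lambda>x::'a::euclidean_space ^ 'n. x $ i) \<in> borel_measurable borel"
  by (intro borel_measurable_continuous_onI continuous_intros)

lemma prod_Basis_vec:
  fixes f :: "'a::euclidean_space ^ 'n \<Rightarrow> 'b::comm_monoid_mult"
  shows "(\<Prod>b\<in>Basis. f b) = (\<Prod>i\<in>UNIV. \<Prod>u\<in>Basis. f (axis i u))"
proof -
  let ?g = "\<lambda>(i, u). axis i u :: 'a ^ 'n"
  have Basis: "(Basis :: ('a ^ 'n) set) = ?g ` (UNIV \<times> Basis)"
    by (auto simp: Basis_vec_def)
  \<comment> \<open>A nonzero \<open>u\<close> can be recovered from \<open>axis i u\<close>
    together with its position \<open>i\<close>.\<close>
  have inj: "inj_on ?g (UNIV \<times> Basis)"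
    by (auto simp: inj_on_def axis_eq_axis nonzero_Basis)
  show ?thesis
    unfolding Basis prod.reindex[OF inj]
    by (simp add: prod.cartesian_product case_prod_unfold)
qed

lemma borel_measurable_vec_lambda [measurable]:
  "vec_lambda \<in> (PiM UNIV (\<lambda>_::'n::finite. lborel :: 'a::euclidean_space measure)) \<rightarrow>\<^sub>M borel"
  by (subst borel_measurable_euclidean_space) (auto simp: Basis_vec_def inner_axis)

text \<open>Lebesgue measure is determined by its values on boxes, and \<open>vec_lambda\<close>
  pulls a box back to a product of boxes. This opens the way to Tonelli's theorem for
  \<open>PiM\<close>.\<close>

lemma lborel_vec_eq_distr_PiM:
  "(lborel :: ('a::euclidean_space ^ 'n) measure) = distr (PiM UNIV (\<lambda>_. lborel)) borel vec_lambda"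
proof (rule lborel_eqI)
  interpret product_sigma_finite "\<lambda>_::'n. lborel :: 'a measure" by standard
  fix l u :: "'a ^ 'n"
  assume le: "\<And>b. b \<in> Basis \<Longrightarrow> l \<bullet> b \<le> u \<bullet> b"
  then have le': "(l $ i) \<bullet> b \<le> (u $ i) \<bullet> b" if "b \<in> Basis" for i b
    using that by (force simp: Basis_vec_def inner_axis)
  have vim: "vec_lambda -` box l u \<inter> space (PiM UNIV (\<lambda>_::'n. lborel :: 'a measure)) =
      (\<Pi>\<^sub>E i\<in>UNIV. box (l $ i) (u $ i))"
    by (auto simp: box_def Basis_vec_def inner_axis PiE_def space_PiM)
  show "emeasure (distr (PiM UNIV (\<lambda>_. lborel)) borel vec_lambda) (box l u) =
      ennreal (\<Prod>b\<in>Basis. (u - l) \<bullet> b)"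
    using le' by (simp add: emeasure_distr vim emeasure_PiM prod_Basis_vec inner_axis
        emeasure_lborel_box prod_ennreal inner_diff_left prod_nonneg)
qed simp

lemma nn_integral_lborel_vec_prod:
  fixes f :: "'n::finite \<Rightarrow> 'a::euclidean_space \<Rightarrow> ennreal"
  assumes [measurable]: "\<And>i. f i \<in> borel_measurable borel"
  shows "(\<integral>\<^sup>+x. (\<Prod>i\<in>UNIV. f i (x $ i)) \<partial>(lborel :: ('a ^ 'n) measure)) =
    (\<Prod>i\<in>UNIV. \<integral>\<^sup>+y. f i y \<partial>lborel)"
proof -
  interpret product_sigma_finite "\<lambda>_::'n. lborel :: 'a measure" by standard
  show ?thesis
    by (subst lborel_vec_eq_distr_PiM, subst nn_integral_distr)
      (auto simp: product_nn_integral_prod)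
qed

section \<open>Iterated \<open>lp_norm\<close> combinations and their unit balls\<close>

lemma lp_norm_infinity_le_iff: "lp_norm \<infinity> v \<le> r \<longleftrightarrow> (\<forall>k. \<bar>v $ k\<bar> \<le> r)"
  by (simp add: lp_norm_def)

lemma lp_norm_powr:
  assumes "0 < q"
  shows "lp_norm (ereal q) v powr q = (\<Sum>k\<in>UNIV. \<bar>v $ k\<bar> powr q)"
  using assms by (simp add: lp_norm_def powr_powr sum_nonneg)

text \<open>Homogeneity, unlike the triangle inequality, survives for exponents below 1, so the
  quasi-norm range is covered too.\<close>

lemma pos_homogeneous_lp_norm:
  assumes "0 < p"
  shows "pos_homogeneous (lp_norm p :: real ^ 'n \<Rightarrow> real)"
proof (cases p)
  case (real r)
  with assms have r: "0 < r" by simp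
  have "(\<Sum>k\<in>UNIV. \<bar>c * x $ k\<bar> powr r) powr (1 / r) = c * (\<Sum>k\<in>UNIV. \<bar>x $ k\<bar> powr r) powr (1 / r)"
    if "0 < c" for c and x :: "real ^ 'n"
    using that r
    by (simp add: abs_mult powr_mult sum_distrib_left[symmetric] sum_nonneg powr_powr)
  with real show ?thesis
    by (auto simp: pos_homogeneous_def lp_norm_def[abs_def])
next
  case PInf
  have "Max (range (\<lambda>k. \<bar>c * x $ k\<bar>)) = c * Max (range (\<lambda>k. \<bar>x $ k\<bar>))"
    if "0 < c" for c and x :: "real ^ 'n"
  proof -
    have "c * Max (range (\<lambda>k. \<bar>x $ k\<bar>)) = Max ((\<lambda>t. c * t) ` range (\<lambda>k. \<bar>x $ k\<bar>))"
      using that by (intro mono_Max_commute) (auto intro!: monoI)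
    then show ?thesis
      using that by (simp add: image_image abs_mult)
  qed
  moreover have "0 \<le> Max (range (\<lambda>k. \<bar>x $ k\<bar>))" for x :: "real ^ 'n"
    by (rule order_trans[OF abs_ge_zero Max_ge]) auto
  ultimately show ?thesis
    using PInf by (auto simp: pos_homogeneous_def lp_norm_def[abs_def])
qed (use assms in auto)

text \<open>Makes the exponential integral formula applicable to the combined function, and yields
  measurability of the mixed ball.\<close>

lemma pos_homogeneous_lp_combination:
  fixes N :: "'a::euclidean_space \<Rightarrow> real"
  assumes N: "pos_homogeneous N" and "0 < p"
  shows "pos_homogeneous (\<lambda>x :: 'a ^ 'n. lp_norm p (\<chi> j. N (x $ j)))"
proof -
  note [measurable] = pos_homogeneousD(1)[OF N]
  note L = pos_homogeneous_lp_norm[OF \<open>0 < p\<close>, where 'n = 'n]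
  note [measurable] = pos_homogeneousD(1)[OF L]
  have [measurable]: "(\<lambda>x :: 'a ^ 'n. \<chi> j. N (x $ j)) \<in> borel_measurable borel"
    by (subst borel_measurable_euclidean_space) (auto simp: Basis_vec_def inner_axis)
  have "(\<chi> j. N ((c *\<^sub>R x) $ j)) = c *\<^sub>R (\<chi> j. N (x $ j))" if "0 < c" for c and x :: "'a ^ 'n"
    using that by (simp add: vec_eq_iff pos_homogeneousD(3)[OF N])
  then show ?thesis
    by (simp add: pos_homogeneous_def pos_homogeneousD(2,3)[OF L])
qed

text \<open>One formula serves all exponents: for \<open>p = \<infinity>\<close> the quotients by
  \<open>p\<close> are 0, and both Gamma values become \<open>Gamma 1 = 1\<close>.\<close>

lemma emeasure_lp_combination:
  fixes N :: "'a::euclidean_space \<Rightarrow> real"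
  assumes N: "pos_homogeneous N" and p: "0 < p"
    and v: "emeasure lborel {x. N x \<le> 1} = ennreal v" "0 \<le> v"
  shows "emeasure lborel {x :: 'a ^ 'n. lp_norm p (\<chi> j. N (x $ j)) \<le> 1} =
    ennreal (v ^ CARD('n) * Gamma (real_of_ereal (ereal (real DIM('a)) / p) + 1) ^ CARD('n)
      / Gamma (real_of_ereal (ereal (real (CARD('n) * DIM('a))) / p) + 1))"
proof (cases p)
  case (real q)
  with p have q: "0 < q" by simp
  note [measurable] = pos_homogeneousD(1)[OF N]
  let ?F = "\<lambda>x :: 'a ^ 'n. lp_norm p (\<chi> j. N (x $ j))"
  let ?G = "Gamma (real DIM('a) / q + 1)" and ?H = "Gamma (real (CARD('n) * DIM('a)) / q + 1)"
  have G: "0 < ?G" and H: "0 < ?H"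
    using q by (auto intro!: Gamma_real_pos add_nonneg_pos)
  have F: "?F x powr q = (\<Sum>j\<in>UNIV. N (x $ j) powr q)" for x
    unfolding real lp_norm_powr[OF q] by (simp add: abs_of_nonneg pos_homogeneousD(2)[OF N])
  \<comment> \<open>The same integral is evaluated twice: here through the unit ball of
    \<open>?F\<close> in dimension \<open>CARD('n) * DIM('a)\<close>, below as a product over the
    coordinates.\<close>
  have "emeasure lborel {x. ?F x \<le> 1} * ennreal ?H = (\<integral>\<^sup>+x. ennreal (exp (- (?F x powr q))) \<partial>lborel)"
    by (subst nn_integral_exp_pos_homogeneous[OF pos_homogeneous_lp_combination[OF N p] q]) simp
  also have "\<dots> = (\<integral>\<^sup>+x. (\<Prod>j\<in>UNIV. ennreal (exp (- (N (x $ j) powr q)))) \<partial>(lborel :: ('a ^ 'n) measure))"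
    by (simp add: F prod_ennreal exp_sum sum_negf[symmetric])
  also have "\<dots> = (\<integral>\<^sup>+y. ennreal (exp (- (N y powr q))) \<partial>lborel) ^ CARD('n)"
    by (subst nn_integral_lborel_vec_prod) auto
  also have "\<dots> = ennreal ((v * ?G) ^ CARD('n))"
    using v(2) G by (simp add: nn_integral_exp_pos_homogeneous[OF N q] v(1) ennreal_power
        ennreal_mult[symmetric])
  finally have *: "emeasure lborel {x. ?F x \<le> 1} * ennreal ?H = ennreal ((v * ?G) ^ CARD('n))" .
  have "emeasure lborel {x. ?F x \<le> 1} = emeasure lborel {x. ?F x \<le> 1} * ennreal ?H / ennreal ?H"
    using H by (simp add: ennreal_mult_divide_eq)
  also have "\<dots> = ennreal ((v * ?G) ^ CARD('n) / ?H)"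
    using H G v(2) by (simp only: *) (simp add: divide_ennreal)
  finally show ?thesis
    using real q by (simp add: power_mult_distrib)
next
  case PInf
  note [measurable] = pos_homogeneousD(1)[OF N]
  have "{x :: 'a ^ 'n. lp_norm p (\<chi> j. N (x $ j)) \<le> 1} = {x. \<forall>j. N (x $ j) \<le> 1}"
    using PInf by (simp add: lp_norm_infinity_le_iff pos_homogeneousD(2)[OF N])
  then have "emeasure lborel {x :: 'a ^ 'n. lp_norm p (\<chi> j. N (x $ j)) \<le> 1} =
      (\<integral>\<^sup>+x. indicator {x. \<forall>j. N (x $ j) \<le> 1} x \<partial>(lborel :: ('a ^ 'n) measure))"
    by simp
  \<comment> \<open>The indicator of the product set factorises, taking the place of the exponential
    in the finite case.\<close>
  also have "\<dots> = (\<integral>\<^sup>+x. (\<Prod>j\<in>UNIV. indicator {y. N y \<le> 1} (x $ j)) \<partial>(lborel :: ('a ^ 'n) measure))"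
    by (intro nn_integral_cong) (auto simp: indicator_def prod.neutral)
  also have "\<dots> = ennreal v ^ CARD('n)"
    by (subst nn_integral_lborel_vec_prod) (auto simp: v(1))
  finally show ?thesis
    using PInf v(2) by (simp add: ennreal_power)
qed (use p in auto)

theorem theorem3:
  fixes p q :: ereal
  assumes "0 < p" and "0 < q"
  shows "measure lebesgue (mixed_ball p q :: (real ^ 'm ^ 'n) set) =
    2 ^ (CARD('m) * CARD('n))
    * (Gamma (real_of_ereal (1 / p) + 1) ^ (CARD('m) * CARD('n))
       / Gamma (real_of_ereal (ereal (real (CARD('n) * CARD('m))) / q) + 1))
    * (Gamma (real_of_ereal (ereal (real CARD('m)) / q) + 1) ^ CARD('n)
       / Gamma (real_of_ereal (ereal (real CARD('m)) / p) + 1) ^ CARD('n))"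
proof -
  have Gpos: "0 < Gamma (real_of_ereal (ereal (real k) / r) + 1)" if "0 < r" for k r
    using that by (cases r) (auto intro!: Gamma_real_pos add_nonneg_pos)
  have abs: "pos_homogeneous (\<lambda>x::real. \<bar>x\<bar>)"
    by (auto simp: pos_homogeneous_def abs_mult)
  have "{x::real. \<bar>x\<bar> \<le> 1} = {-1..1}" by auto
  then have "emeasure lborel {x::real. \<bar>x\<bar> \<le> 1} = ennreal 2" by simp
  \<comment> \<open>First application: dimension 1 and volume 2, giving the unit ball of a single
    row.\<close>
  note row = emeasure_lp_combination[OF abs \<open>0 < p\<close> this, where 'n = 'm]
  let ?v = "2 ^ CARD('m) * Gamma (real_of_ereal (1 / p) + 1) ^ CARD('m)
      / Gamma (real_of_ereal (ereal (real CARD('m)) / p) + 1)"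
  have lp_abs: "lp_norm p (\<chi> j. \<bar>x $ j\<bar>) = lp_norm p x" for x :: "real ^ 'm"
    by (simp add: lp_norm_def)
  have v: "emeasure lborel {x :: real ^ 'm. lp_norm p x \<le> 1} = ennreal ?v"
    using row by (simp add: lp_abs one_ereal_def)
  have v0: "0 \<le> ?v"
    using Gpos[OF \<open>0 < p\<close>, of 1] Gpos[OF \<open>0 < p\<close>, of "CARD('m)"]
    by (intro divide_nonneg_pos mult_nonneg_nonneg zero_le_power) (simp_all add: one_ereal_def)
  note N = pos_homogeneous_lp_norm[OF \<open>0 < p\<close>, where 'n = 'm]
  let ?w = "?v ^ CARD('n) * Gamma (real_of_ereal (ereal (real CARD('m)) / q) + 1) ^ CARD('n)
      / Gamma (real_of_ereal (ereal (real (CARD('n) * CARD('m))) / q) + 1)"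
  have ball: "(mixed_ball p q :: (real ^ 'm ^ 'n) set) = {x. lp_norm q (\<chi> j. lp_norm p (x $ j)) \<le> 1}"
    by (simp add: mixed_ball_def mixed_norm_def)
  have meas: "(mixed_ball p q :: (real ^ 'm ^ 'n) set) \<in> sets lborel"
    using pos_homogeneousD(1)[OF pos_homogeneous_lp_combination[OF N \<open>0 < q\<close>, where 'n = 'n]]
    unfolding ball by measurable
  \<comment> \<open>Second application: the rows have dimension \<open>CARD('m)\<close> and their
    unit ball has volume \<open>?v\<close>.\<close>
  have "emeasure lborel (mixed_ball p q :: (real ^ 'm ^ 'n) set) = ennreal ?w"
    unfolding ball using emeasure_lp_combination[OF N \<open>0 < q\<close> v v0, where 'n = 'n] by simp
  moreover have "0 \<le> ?w"
    using v0 Gpos[OF \<open>0 < q\<close>, of "CARD('m)"] Gpos[OF \<open>0 < q\<close>, of "CARD('n) * CARD('m)"]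
    by (meson zero_le_power mult_nonneg_nonneg divide_nonneg_pos less_imp_le)
  \<comment> \<open>\<open>lebesgue\<close> is the completion of \<open>lborel\<close>, so the two
    agree on the Borel set \<open>mixed_ball p q\<close>.\<close>
  ultimately have "measure lebesgue (mixed_ball p q :: (real ^ 'm ^ 'n) set) = ?w"
    using meas by (simp add: measure_completion measure_def)
  then show ?thesis
    by (simp add: power_mult_distrib power_divide power_mult mult_ac)
qed

end
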